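(* Let $n\ge 5$ be an integer and let $Y$ be a graph on $n$ vertices with minimum degree $\delta(Y)=n-4$. Then the friends-and-strangers graph $\mathsf{FS}(\mathsf{Lollipop}_{n-5,5},Y)$ is connected if and only if $Y$ does not contain any induced subgraph isomorphic to $\mathsf{Complete}_3\cup\mathsf{Path}_2$ or to $\mathsf{Path}_3\cup\mathsf{Path}_2$.
   Context: All graphs are finite and simple (no loops, no multiple edges). Friends-and-strangers graph: for two graphs $X$ and $Y$, each with $n$ vertices, $\mathsf{FS}(X,Y)$ is the graph whose vertices are all bijections $\sigma:V(X)\to V(Y)$, where two bijections $\sigma,\sigma'$ are adjacent if and only if there is an edge $\{a,b\}\in E(X)$ such that $\{\sigma(a),\sigma(b)\}\in E(Y)$, $\sigma(a)=\sigma'(b)$, $\sigma(b)=\sigma'(a)$, and $\sigma(c)=\sigma'(c)$ for all $c\in V(X)\setminus\{a,b\}$. Lollipop graph: for $2\le k\le n$, $\mathsf{Lollipop}_{n-k,k}$ is the graph of order $n$ obtained by identifying one end of a path with $n-k+1$ vertices with a vertex of a complete graph on $k$ vertices. Concretely, it has vertex set $\{1,\dots,n\}$, with edges $\{i,i+1\}$ for $1\le i\le n-k$ together with all edges $\{i,j\}$ with $n-k+1\le i<j\le n$. (For $k=n$ it is the complete graph on $n$ vertices.) $\mathsf{Path}_m$ and $\mathsf{Complete}_m$ denote the path and the complete graph with $m$ vertices, respectively, and $G\cup H$ denotes the disjoint union of graphs $G$ and $H$. *)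

theory Defs
  imports "Graph_Theory.Graph_Theory" "HOL-Library.FuncSet"
begin

text \<open>
  A finite simple graph is a \<^locale>\<open>pair_graph\<close>: a finite vertex set with a symmetric
  irreflexive set of ordered pairs, so an undirected edge between \<open>u\<close> and \<open>v\<close> is
  represented by both \<open>(u, v)\<close> and \<open>(v, u)\<close>.
\<close>

definition ugraph :: "'a set \<Rightarrow> 'a rel \<Rightarrow> 'a pair_pre_digraph" where
  "ugraph V R = \<lparr>pverts = V, parcs = R \<union> R\<inverse>\<rparr>"

definition complete_graph :: "nat \<Rightarrow> nat pair_pre_digraph" where
  "complete_graph m = ugraph {1..m} {(i, j). 1 \<le> i \<and> i < j \<and> j \<le> m}"

definition path_graph :: "nat \<Rightarrow> nat pair_pre_digraph" where
  "path_graph m = ugraph {1..m} {(i, i + 1) | i. 1 \<le> i \<and> i + 1 \<le> m}"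

text \<open>
  The first argument of \<open>lollipop\<close> is the number of vertices outside the clique, so
  \<open>lollipop (n - k) k\<close> has \<open>n\<close> vertices whenever \<open>k \<le> n\<close>.
\<close>

definition lollipop :: "nat \<Rightarrow> nat \<Rightarrow> nat pair_pre_digraph" where
  "lollipop m k = ugraph {1..m + k}
     ({(i, i + 1) | i. 1 \<le> i \<and> i \<le> m} \<union> {(i, j). m + 1 \<le> i \<and> i < j \<and> j \<le> m + k})"

definition disjoint_union ::
  "'a pair_pre_digraph \<Rightarrow> 'b pair_pre_digraph \<Rightarrow> ('a + 'b) pair_pre_digraph" where
  "disjoint_union G H =
     \<lparr>pverts = pverts G <+> pverts H,
      parcs = map_prod Inl Inl ` parcs G \<union> map_prod Inr Inr ` parcs H\<rparr>"

text \<open>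
  In a simple graph the out-degree is the degree. The value is meaningful only for a graph
  with finite nonempty vertex set.
\<close>

definition min_degree :: "'a pair_pre_digraph \<Rightarrow> nat" where
  "min_degree G = Min (out_degree (with_proj G) ` pverts G)"

definition has_induced_copy :: "'a pair_pre_digraph \<Rightarrow> 'b pair_pre_digraph \<Rightarrow> bool" where
  "has_induced_copy G H \<longleftrightarrow>
     (\<exists>K. induced_subgraph K (with_proj G) \<and> digraph_iso K (with_proj H))"

text \<open>
  Bijections between the vertex sets are taken \<^const>\<open>extensional\<close>, so that each of them
  is represented by exactly one HOL function.
\<close>

definition fs_verts :: "'a pair_pre_digraph \<Rightarrow> 'b pair_pre_digraph \<Rightarrow> ('a \<Rightarrow> 'b) set" where
  "fs_verts X Y = {\<sigma> \<in> extensional (pverts X). bij_betw \<sigma> (pverts X) (pverts Y)}"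

definition fs_graph ::
  "'a pair_pre_digraph \<Rightarrow> 'b pair_pre_digraph \<Rightarrow> ('a \<Rightarrow> 'b) pair_pre_digraph" where
  "fs_graph X Y =
     \<lparr>pverts = fs_verts X Y,
      parcs = {(\<sigma>, \<tau>). \<sigma> \<in> fs_verts X Y \<and> \<tau> \<in> fs_verts X Y \<and>
        (\<exists>a b. (a, b) \<in> parcs X \<and> (\<sigma> a, \<sigma> b) \<in> parcs Y \<and>
          \<sigma> a = \<tau> b \<and> \<sigma> b = \<tau> a \<and> (\<forall>c \<in> pverts X - {a, b}. \<sigma> c = \<tau> c))}\<rparr>"

lemma pair_graphI:
  assumes "finite (pverts G)" "parcs G \<subseteq> pverts G \<times> pverts G" "irrefl (parcs G)" "sym (parcs G)"
  shows "pair_graph G"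
proof -
  have "finite (parcs G)"
    using assms(1,2) finite_subset by blast
  then show ?thesis
    using assms by unfold_locales (auto simp: symmetric_def irrefl_def)
qed

lemma pair_graph_complete_graph: "pair_graph (complete_graph m)"
  by (rule pair_graphI) (auto simp: complete_graph_def ugraph_def irrefl_def sym_def)

lemma pair_graph_path_graph: "pair_graph (path_graph m)"
  by (rule pair_graphI) (auto simp: path_graph_def ugraph_def irrefl_def sym_def)

lemma pair_graph_lollipop: "1 \<le> k \<Longrightarrow> pair_graph (lollipop m k)"
  by (rule pair_graphI) (auto simp: lollipop_def ugraph_def irrefl_def sym_def)

lemma pair_graph_disjoint_union:
  assumes "pair_graph G" "pair_graph H"
  shows "pair_graph (disjoint_union G H)"
proof -
  interpret G: pair_graph G by fact
  interpret H: pair_graph H by fact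
  show ?thesis
  proof (rule pair_graphI)
    show "sym (parcs (disjoint_union G H))"
      using G.pair_sym_arcs H.pair_sym_arcs
      by (force simp: disjoint_union_def sym_def symmetric_def)
  qed (auto simp: disjoint_union_def irrefl_def G.pair_finite_verts H.pair_finite_verts
       dest: G.wellformed' H.wellformed' G.pair_no_loops H.pair_no_loops)
qed

lemma pair_graph_fs_graph:
  assumes "pair_graph X" "pair_graph Y"
  shows "pair_graph (fs_graph X Y)"
proof -
  interpret X: pair_graph X by fact
  interpret Y: pair_graph Y by fact
  show ?thesis
  proof (rule pair_graphI)
    have "fs_verts X Y \<subseteq> pverts X \<rightarrow>\<^sub>E pverts Y"
      by (auto simp: fs_verts_def PiE_def bij_betw_def)
    moreover have "finite (pverts X \<rightarrow>\<^sub>E pverts Y)"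
      by (intro finite_PiE X.pair_finite_verts Y.pair_finite_verts)
    ultimately show "finite (pverts (fs_graph X Y))"
      by (simp add: fs_graph_def finite_subset)
    show "irrefl (parcs (fs_graph X Y))"
      by (auto simp: fs_graph_def irrefl_def dest: Y.pair_no_loops)
    have "sym (parcs X)"
      using X.pair_sym_arcs by (simp add: symmetric_def)
    show "sym (parcs (fs_graph X Y))"
    proof (rule symI)
      fix \<sigma> \<tau>
      assume "(\<sigma>, \<tau>) \<in> parcs (fs_graph X Y)"
      then obtain a b where "\<sigma> \<in> fs_verts X Y" "\<tau> \<in> fs_verts X Y" "(a, b) \<in> parcs X"
        "(\<sigma> a, \<sigma> b) \<in> parcs Y" "\<sigma> a = \<tau> b" "\<sigma> b = \<tau> a" "\<forall>c \<in> pverts X - {a, b}. \<sigma> c = \<tau> c"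
        by (auto simp: fs_graph_def)
      moreover from this \<open>sym (parcs X)\<close> have "(b, a) \<in> parcs X"
        by (auto dest: symD)
      ultimately have "(b, a) \<in> parcs X \<and> (\<tau> b, \<tau> a) \<in> parcs Y \<and> \<tau> b = \<sigma> a \<and> \<tau> a = \<sigma> b \<and>
          (\<forall>c \<in> pverts X - {b, a}. \<tau> c = \<sigma> c)"
        by auto
      with \<open>\<sigma> \<in> fs_verts X Y\<close> \<open>\<tau> \<in> fs_verts X Y\<close> show "(\<tau>, \<sigma>) \<in> parcs (fs_graph X Y)"
        unfolding fs_graph_def by auto
    qed
  qed (auto simp: fs_graph_def)
qed

end

theory Submission
  imports Defs "HOL-Combinatorics.Permutations"
begin

text \<open>
  For every \<open>k \<ge> 2\<close>, the graph on the bijections \<open>{1..m + k} \<rightarrow> V(Y)\<close> defined by \<open>lollipop m k\<close> is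
  connected iff every \<open>k\<close>-subset of \<open>V(Y)\<close> induces a connected subgraph.

  If \<open>S\<close> is a \<open>k\<close>-subset that splits into \<open>A\<close> and \<open>S - A\<close> with no edges between them, then only \<open>m\<close> people lie
  outside \<open>S\<close>, so the \<open>m + 1\<close> path positions always hold a member of \<open>S\<close>. Whether the first of these
  belongs to \<open>A\<close> never changes, although both possibilities occur.

  Conversely, fix the person \<open>y\<close> at the end of the path: by induction on \<open>m\<close>, applied to \<open>Y - y\<close>, all
  arrangements with \<open>y\<close> at the end are in one component. Swapping the first two positions joins the
  components of \<open>y\<close> and \<open>z\<close> whenever \<open>yz\<close> is an edge, and \<open>Y\<close> is connected. For \<open>m = 0\<close> the
  transpositions along the edges of a connected graph generate the symmetric group.

  When \<open>k = 5\<close> and the minimum degree is \<open>n - 4\<close>, every vertex of a 5-subset has a neighbour in it, so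
  a disconnected one splits into a connected triple and an edge.
\<close>

section \<open>Connectivity expressed through cuts\<close>

text \<open>For symmetric \<open>E\<close> this is connectivity of the subgraph induced on
  \<open>S\<close>. The cut form makes its negation hand over the set \<open>A\<close> from which
  the invariant is built.\<close>

definition inseparable :: "'a rel \<Rightarrow> 'a set \<Rightarrow> bool" where
  "inseparable E S \<longleftrightarrow> (\<forall>A. A \<noteq> {} \<longrightarrow> A \<subset> S \<longrightarrow> E \<inter> A \<times> (S - A) \<noteq> {})"

text \<open>The points reachable from \<open>a\<close> within \<open>W\<close> have no edge to the
  rest of \<open>W\<close>, so they would form a cut if \<open>b\<close> were missing.\<close>

lemma inseparable_imp_rtrancl:
  assumes "inseparable E W" "a \<in> W" "b \<in> W"
  shows "(a, b) \<in> (Restr E W)\<^sup>*"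
proof (rule ccontr)
  assume no: "(a, b) \<notin> (Restr E W)\<^sup>*"
  define A where "A = {c \<in> W. (a, c) \<in> (Restr E W)\<^sup>*}"
  have "a \<in> A" "b \<notin> A"
    using assms no by (auto simp: A_def)
  with assms(3) have "A \<noteq> {}" "A \<subset> W"
    by (auto simp: A_def)
  with assms(1) have "E \<inter> A \<times> (W - A) \<noteq> {}"
    by (simp add: inseparable_def)
  then obtain c d where "c \<in> A" "d \<in> W - A" "(c, d) \<in> Restr E W"
    by (auto simp: A_def)
  then show False
    by (auto simp: A_def dest: rtrancl_into_rtrancl)
qed

text \<open>A cut of \<open>W\<close> cuts every \<open>k\<close>-subset that meets both sides, and
  \<open>2 \<le> k\<close> leaves room for one point of each.\<close>

lemma inseparable_superset:
  assumes "finite W" "2 \<le> k" "k \<le> card W"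
    and sub: "\<And>S. S \<subseteq> W \<Longrightarrow> card S = k \<Longrightarrow> inseparable E S"
  shows "inseparable E W"
  unfolding inseparable_def
proof (intro allI impI)
  fix A assume "A \<noteq> {}" "A \<subset> W"
  then obtain a b where ab: "a \<in> A" "b \<in> W - A"
    by blast
  then have "a \<noteq> b" "{a, b} \<subseteq> W"
    using \<open>A \<subset> W\<close> by auto
  then obtain S where S: "{a, b} \<subseteq> S" "S \<subseteq> W" "card S = k"
    using exists_subset_between[of "{a, b}" k W] assms(1-3) by auto
  have "A \<inter> S \<noteq> {}" "A \<inter> S \<subset> S"
    using ab S by auto
  then have "E \<inter> (A \<inter> S) \<times> (S - A \<inter> S) \<noteq> {}"
    using sub[OF S(2,3)] by (simp add: inseparable_def)
  with S show "E \<inter> A \<times> (W - A) \<noteq> {}"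
    by blast
qed

section \<open>Rearrangements on a clique of positions\<close>

text \<open>The moves act on arbitrary functions, without fixed domain or range. An induction can
  thus restrict attention to fewer positions while the other values are simply carried
  along.\<close>

definition swap_rel :: "'v rel \<Rightarrow> 'a rel \<Rightarrow> ('v \<Rightarrow> 'a) rel" where
  "swap_rel R E = {(\<sigma>, \<sigma> \<circ> transpose i j) | \<sigma> i j. (i, j) \<in> R \<and> (\<sigma> i, \<sigma> j) \<in> E}"

lemma swap_relI: "(i, j) \<in> R \<Longrightarrow> (\<sigma> i, \<sigma> j) \<in> E \<Longrightarrow> (\<sigma>, \<sigma> \<circ> transpose i j) \<in> swap_rel R E"
  by (auto simp: swap_rel_def)

lemma bij_betw_comp_transpose:
  assumes "bij_betw \<sigma> P W" "i \<in> P" "j \<in> P"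
  shows "bij_betw (\<sigma> \<circ> transpose i j) P W"
  using assms permutes_swap_id[of i P j] permutes_imp_bij bij_betw_trans by blast

text \<open>Induction along the walk from \<open>a\<close> to \<open>b\<close>: the exchange with
  the last person is the exchange with the previous one, conjugated by legal swaps.\<close>

lemma clique_transpose:
  assumes clique: "\<And>i j. i \<in> P \<Longrightarrow> j \<in> P \<Longrightarrow> i \<noteq> j \<Longrightarrow> (i, j) \<in> R"
    and "sym E" "(a, b) \<in> (Restr E W)\<^sup>*"
    and "bij_betw \<sigma> P W" "p \<in> P" "q \<in> P" "\<sigma> p = a" "\<sigma> q = b"
  shows "(\<sigma>, \<sigma> \<circ> transpose p q) \<in> (swap_rel R E)\<^sup>*"
  using assms(3-)
proof (induction b arbitrary: \<sigma> p q rule: rtrancl_induct)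
  case base
  then have "p = q"
    by (auto simp: bij_betw_def inj_on_def)
  then show ?case
    by simp
next
  case (step b c)
  then have bc: "(b, c) \<in> E" "(c, b) \<in> E" "b \<in> W"
    using \<open>sym E\<close> by (auto dest: symD)
  then obtain r where r: "r \<in> P" "\<sigma> r = b"
    using step.prems(1) by (auto simp: bij_betw_def)
  have inj: "\<And>i j. i \<in> P \<Longrightarrow> j \<in> P \<Longrightarrow> \<sigma> i = \<sigma> j \<Longrightarrow> i = j"
    using step.prems(1) by (auto simp: bij_betw_def inj_on_def)
  \<comment> \<open>The first three cases are degenerate: the walk has returned to \<open>a\<close>,
    its last edge starts at \<open>a\<close>, or its last edge is a loop. Only the fourth needs
    conjugation.\<close>
  consider "p = q" | "p \<noteq> q" "r = p" | "p \<noteq> q" "r = q" | "p \<noteq> q" "r \<noteq> p" "r \<noteq> q"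
    by blast
  then show ?case
  proof cases
    case 2
    then have "(\<sigma>, \<sigma> \<circ> transpose p q) \<in> swap_rel R E"
      using bc r step.prems clique by (intro swap_relI) auto
    then show ?thesis ..
  next
    case 3
    with r step have "b = c" by simp
    with step show ?thesis by blast
  next
    case 4
    (* (p q) = (r q)(p q)(p r), where the middle factor is covered by the induction hypothesis *)
    define \<sigma>1 where "\<sigma>1 = \<sigma> \<circ> transpose r q"
    define \<sigma>2 where "\<sigma>2 = \<sigma>1 \<circ> transpose p q"
    have \<sigma>1: "\<sigma>1 p = \<sigma> p" "\<sigma>1 q = b" "\<sigma>1 r = c"
      using 4 r step.prems by (auto simp: \<sigma>1_def transpose_def)
    have "(\<sigma>, \<sigma>1) \<in> swap_rel R E"
      unfolding \<sigma>1_def using 4 bc r step.prems clique by (intro swap_relI) auto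
    moreover have "(\<sigma>1, \<sigma>2) \<in> (swap_rel R E)\<^sup>*"
      unfolding \<sigma>2_def
    proof (rule step.IH)
      show "bij_betw \<sigma>1 P W"
        unfolding \<sigma>1_def using r step.prems by (intro bij_betw_comp_transpose)
    qed (use r step.prems \<sigma>1 in auto)
    moreover have "(\<sigma>2, \<sigma>2 \<circ> transpose p r) \<in> swap_rel R E"
      using 4 bc r step.prems clique \<sigma>1 by (intro swap_relI) (auto simp: \<sigma>2_def)
    moreover have "\<sigma>2 \<circ> transpose p r = \<sigma> \<circ> transpose p q"
      using 4 by (auto simp: \<sigma>1_def \<sigma>2_def transpose_def fun_eq_iff)
    ultimately show ?thesis
      by (metis converse_rtrancl_into_rtrancl rtrancl_into_rtrancl)
  qed simp
qed

text \<open>Transpositions generate all permutations of \<open>P\<close>, and each is realised by a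
  walk between the two people concerned.\<close>

lemma clique_connected:
  assumes "finite P" and clique: "\<And>i j. i \<in> P \<Longrightarrow> j \<in> P \<Longrightarrow> i \<noteq> j \<Longrightarrow> (i, j) \<in> R"
    and "sym E" "inseparable E W"
    and bij: "bij_betw \<sigma> P W" "bij_betw \<tau> P W" and eq: "\<And>i. i \<notin> P \<Longrightarrow> \<sigma> i = \<tau> i"
  shows "(\<sigma>, \<tau>) \<in> (swap_rel R E)\<^sup>*"
proof -
  have perm: "(\<sigma>, \<sigma> \<circ> \<pi>) \<in> (swap_rel R E)\<^sup>*" if "\<pi> permutes P" "bij_betw \<sigma> P W" for \<pi> \<sigma>
    using that(1) \<open>finite P\<close> that
  proof (induction arbitrary: \<sigma> rule: permutes_induct)
    case (swap a b p)
    have "(\<sigma>, \<sigma> \<circ> transpose a b) \<in> (swap_rel R E)\<^sup>*"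
    proof (rule clique_transpose)
      from swap \<open>inseparable E W\<close> show "(\<sigma> a, \<sigma> b) \<in> (Restr E W)\<^sup>*"
        by (intro inseparable_imp_rtrancl) (auto simp: bij_betw_def)
    qed (use swap clique \<open>sym E\<close> in auto)
    moreover have "(\<sigma> \<circ> transpose a b, \<sigma> \<circ> transpose a b \<circ> p) \<in> (swap_rel R E)\<^sup>*"
      using swap by (blast intro: bij_betw_comp_transpose)
    ultimately show ?case
      unfolding comp_assoc by (rule rtrancl_trans)
  qed simp
  \<comment> \<open>The permutation of positions that turns \<open>\<sigma>\<close> into
    \<open>\<tau>\<close>, extended by the identity as \<open>permutes\<close> requires.\<close>
  define \<pi> where "\<pi> i = (if i \<in> P then inv_into P \<sigma> (\<tau> i) else i)" for i
  have "bij_betw (inv_into P \<sigma> \<circ> \<tau>) P P"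
    using bij(2,1) bij_betw_inv_into bij_betw_trans by blast
  then have "bij_betw \<pi> P P"
    by (rule iffD1[OF bij_betw_cong, rotated]) (simp add: \<pi>_def)
  then have "\<pi> permutes P"
    by (rule bij_imp_permutes) (simp add: \<pi>_def)
  moreover have "\<sigma> \<circ> \<pi> = \<tau>"
    using eq bij by (auto simp: \<pi>_def fun_eq_iff bij_betw_inv_into_right bij_betw_apply)
  ultimately show ?thesis
    using perm bij by metis
qed

section \<open>Sufficiency: joining arrangements on a lollipop\<close>

lemma parcs_lollipop:
  assumes "1 \<le> k"
  shows "(i, j) \<in> parcs (lollipop m k) \<longleftrightarrow>
    i \<in> {1..m + k} \<and> j \<in> {1..m + k} \<and> i \<noteq> j \<and> (j = Suc i \<or> i = Suc j \<or> m < i \<and> m < j)"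
  using assms by (auto simp: lollipop_def ugraph_def)

text \<open>Here \<open>d\<close> counts the path positions from \<open>s\<close> to
  \<open>m\<close>; for \<open>d = 0\<close> only the clique remains. Working on final segments of
  one fixed lollipop avoids renumbering a smaller one.\<close>

lemma lollipop_tail_connected:
  assumes "sym E" "2 \<le> k"
  shows "\<lbrakk>1 \<le> s; d + s = Suc m; bij_betw \<sigma> {s..m + k} W; bij_betw \<tau> {s..m + k} W;
      \<And>i. i \<notin> {s..m + k} \<Longrightarrow> \<sigma> i = \<tau> i; \<And>S. S \<subseteq> W \<Longrightarrow> card S = k \<Longrightarrow> inseparable E S\<rbrakk>
    \<Longrightarrow> (\<sigma>, \<tau>) \<in> (swap_rel (parcs (lollipop m k)) E)\<^sup>*"
proof (induction d arbitrary: s \<sigma> \<tau> W)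
  case 0
  have "card W = k"
    using 0(2) bij_betw_same_card[OF 0(3)] by simp
  with 0(6) have "inseparable E W"
    by simp
  show ?case
  proof (rule clique_connected)
    show "(i, j) \<in> parcs (lollipop m k)"
      if "i \<in> {s..m + k}" "j \<in> {s..m + k}" "i \<noteq> j" for i j
      using that 0(2) \<open>2 \<le> k\<close> by (auto simp: parcs_lollipop)
  qed (use 0 \<open>sym E\<close> \<open>inseparable E W\<close> in auto)
next
  case (Suc d)
  let ?P = "{s..m + k}" and ?R = "(swap_rel (parcs (lollipop m k)) E)\<^sup>*"
  have s: "s \<in> ?P" "Suc s \<in> ?P" "s \<le> m"
    using Suc.prems(2) \<open>2 \<le> k\<close> by auto
  \<comment> \<open>With the person at \<open>s\<close> frozen, the induction hypothesis applies to
    the others; the condition on \<open>k\<close>-subsets passes to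
    \<open>W - {\<rho> s}\<close>.\<close>
  have fixed_head: "(\<rho>, \<rho>') \<in> ?R"
    if \<rho>: "bij_betw \<rho> ?P W" "bij_betw \<rho>' ?P W" "\<And>i. i \<notin> ?P \<Longrightarrow> \<rho> i = \<rho>' i" "\<rho> s = \<rho>' s" for \<rho> \<rho>'
  proof (rule Suc.IH[of "Suc s" \<rho> "W - {\<rho> s}" \<rho>'])
    have tail: "{Suc s..m + k} = ?P - {s}"
      using s by auto
    show "bij_betw \<rho> {Suc s..m + k} (W - {\<rho> s})" "bij_betw \<rho>' {Suc s..m + k} (W - {\<rho> s})"
      unfolding tail using \<rho> s by (auto simp: bij_betw_def inj_on_def)
    show "\<rho> i = \<rho>' i" if "i \<notin> {Suc s..m + k}" for i
      using that \<rho>(3,4) unfolding tail by blast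
  qed (use Suc.prems in auto)
  have "finite W" "k \<le> card W"
    using Suc.prems(3) bij_betw_finite bij_betw_same_card[OF Suc.prems(3)] s by auto
  then have "inseparable E W"
    using inseparable_superset \<open>2 \<le> k\<close> Suc.prems(6) by blast
  then have walk: "(\<sigma> s, \<tau> s) \<in> (Restr E W)\<^sup>*"
    using Suc.prems(3,4) s by (intro inseparable_imp_rtrancl) (auto simp: bij_betw_def)
  \<comment> \<open>The person at \<open>s\<close> is changed along a walk in \<open>W\<close>, one
    edge at a time, for all arrangements with the new head at once.\<close>
  have "(\<sigma>, \<rho>) \<in> ?R"
    if "(\<sigma> s, z) \<in> (Restr E W)\<^sup>*" "bij_betw \<rho> ?P W" "\<And>i. i \<notin> ?P \<Longrightarrow> \<sigma> i = \<rho> i" "\<rho> s = z" for z \<rho>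
    using that
  proof (induction arbitrary: \<rho> rule: rtrancl_induct)
    case base
    then show ?case
      using Suc.prems(3) by (intro fixed_head) auto
  next
    case (step y z)
    then obtain p where p: "p \<in> ?P" "\<rho> p = y"
      by (auto simp: bij_betw_def)
    show ?case
    \<comment> \<open>\<open>p = s\<close> means that \<open>y = z\<close>, a loop in the
      walk.\<close>
    proof (cases "p = s")
      case True
      then show ?thesis
        using step p by auto
    next
      case False
      \<comment> \<open>\<open>\<rho>0\<close> has \<open>z\<close> at \<open>s\<close> and
        \<open>y\<close> right behind it; \<open>\<rho>1\<close> has them exchanged. The induction
        hypothesis reaches \<open>\<rho>1\<close>, the edge \<open>yz\<close> gives
        \<open>\<rho>0\<close>, and \<open>fixed_head\<close> leads on to
        \<open>\<rho>\<close>.\<close>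
      define \<rho>0 where "\<rho>0 = \<rho> \<circ> transpose p (Suc s)"
      define \<rho>1 where "\<rho>1 = \<rho>0 \<circ> transpose s (Suc s)"
      have bij: "bij_betw \<rho>0 ?P W" "bij_betw \<rho>1 ?P W"
        unfolding \<rho>1_def \<rho>0_def using p s step.prems by (auto intro!: bij_betw_comp_transpose)
      have val: "\<rho>0 s = z" "\<rho>1 s = y" "\<rho>1 (Suc s) = z"
        using False p step.prems by (auto simp: \<rho>0_def \<rho>1_def transpose_def)
      have outside: "\<rho>0 i = \<rho> i" "\<rho>1 i = \<rho> i" if "i \<notin> ?P" for i
        using p s that by (auto simp: \<rho>0_def \<rho>1_def transpose_def)
      have "(\<sigma>, \<rho>1) \<in> ?R"
        using step.IH bij val outside step.prems by auto
      moreover have "(\<rho>1, \<rho>1 \<circ> transpose s (Suc s)) \<in> swap_rel (parcs (lollipop m k)) E"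
        using val step.hyps s Suc.prems(1) \<open>2 \<le> k\<close> by (intro swap_relI) (auto simp: parcs_lollipop)
      moreover have "\<rho>1 \<circ> transpose s (Suc s) = \<rho>0"
        by (simp add: \<rho>1_def comp_assoc)
      moreover have "(\<rho>0, \<rho>) \<in> ?R"
        using bij val outside step.prems by (intro fixed_head) auto
      ultimately show ?thesis
        by (metis rtrancl_into_rtrancl rtrancl_trans)
    qed
  qed
  then show ?case
    using walk Suc.prems(4,5) by blast
qed

section \<open>From swap moves to the friends-and-strangers graph\<close>

text \<open>Extensional functions agree outside \<open>pverts X\<close>, so the pointwise condition
  on a swap becomes an equation between functions.\<close>

lemma parcs_fs_graph:
  assumes "pair_graph X"
  shows "parcs (fs_graph X Y) = swap_rel (parcs X) (parcs Y) \<inter> fs_verts X Y \<times> fs_verts X Y"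
proof -
  interpret X: pair_graph X by fact
  have "\<tau> = \<sigma> \<circ> transpose a b \<longleftrightarrow>
      \<sigma> a = \<tau> b \<and> \<sigma> b = \<tau> a \<and> (\<forall>c \<in> pverts X - {a, b}. \<sigma> c = \<tau> c)"
    if "(a, b) \<in> parcs X" "\<sigma> \<in> fs_verts X Y" "\<tau> \<in> fs_verts X Y" for a b \<sigma> \<tau>
  proof
    assume R: "\<sigma> a = \<tau> b \<and> \<sigma> b = \<tau> a \<and> (\<forall>c \<in> pverts X - {a, b}. \<sigma> c = \<tau> c)"
    have "\<sigma> c = \<tau> c" if "c \<noteq> a" "c \<noteq> b" for c
      using R that \<open>\<sigma> \<in> _\<close> \<open>\<tau> \<in> _\<close> by (cases "c \<in> pverts X") (auto simp: fs_verts_def extensional_def)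
    with R show "\<tau> = \<sigma> \<circ> transpose a b"
      by (auto simp: fun_eq_iff transpose_def)
  qed (auto simp: transpose_def)
  then have "(\<exists>a b. (a, b) \<in> parcs X \<and> (\<sigma> a, \<sigma> b) \<in> parcs Y \<and> \<sigma> a = \<tau> b \<and> \<sigma> b = \<tau> a \<and>
      (\<forall>c \<in> pverts X - {a, b}. \<sigma> c = \<tau> c)) \<longleftrightarrow> (\<sigma>, \<tau>) \<in> swap_rel (parcs X) (parcs Y)"
    if "\<sigma> \<in> fs_verts X Y" "\<tau> \<in> fs_verts X Y" for \<sigma> \<tau>
    unfolding swap_rel_def using that by blast
  then show ?thesis
    by (auto simp: fs_graph_def)
qed

lemma swap_rel_fs_verts:
  assumes "pair_graph X" "\<sigma> \<in> fs_verts X Y" "(\<sigma>, \<tau>) \<in> swap_rel (parcs X) (parcs Y)"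
  shows "\<tau> \<in> fs_verts X Y"
proof -
  interpret X: pair_graph X by fact
  obtain i j where ij: "(i, j) \<in> parcs X" "\<tau> = \<sigma> \<circ> transpose i j"
    using assms(3) by (auto simp: swap_rel_def)
  then have "i \<in> pverts X" "j \<in> pverts X"
    using X.wellformed' by auto
  then show ?thesis
    using assms(2) bij_betw_comp_transpose[of \<sigma> "pverts X" "pverts Y" i j]
    by (auto simp: fs_verts_def ij(2) extensional_def transpose_def)
qed

text \<open>Swaps preserve \<open>fs_verts\<close>, so a sequence of moves that starts there never
  leaves the graph.\<close>

lemma swap_rel_rtrancl_imp_fs_graph:
  assumes "pair_graph X" "\<sigma> \<in> fs_verts X Y" "(\<sigma>, \<tau>) \<in> (swap_rel (parcs X) (parcs Y))\<^sup>*"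
  shows "(\<sigma>, \<tau>) \<in> (parcs (fs_graph X Y))\<^sup>*"
proof -
  have "(\<sigma>, \<tau>) \<in> (parcs (fs_graph X Y))\<^sup>* \<and> \<tau> \<in> fs_verts X Y"
    using assms(3)
  proof induction
    case (step \<rho> \<tau>)
    then have "\<tau> \<in> fs_verts X Y"
      using swap_rel_fs_verts[OF assms(1)] by blast
    with step show ?case
      by (auto simp: parcs_fs_graph[OF assms(1)] intro: rtrancl_into_rtrancl)
  qed (use assms(2) in auto)
  then show ?thesis ..
qed

text \<open>The library notion uses the symmetric closure and \<open>rtrancl_on\<close>. The arcs
  are already symmetric and join vertices, so plain \<open>rtrancl\<close> suffices.\<close>

lemma connected_pair_graph_iff:
  assumes "pair_graph G"
  shows "Digraph_Component.connected (with_proj G) \<longleftrightarrow>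
    pverts G \<noteq> {} \<and> (\<forall>u \<in> pverts G. \<forall>v \<in> pverts G. (u, v) \<in> (parcs G)\<^sup>*)"
proof -
  interpret pair_graph G by fact
  have "sym (parcs G)"
    using pair_sym_arcs by (simp add: symmetric_def)
  then have "mk_symmetric (with_proj G) = G"
    by (auto simp: mk_symmetric_def sym_def intro!: pair_pre_digraph.equality)
  moreover have "(u, v) \<in> rtrancl_on (pverts G) (parcs G) \<longleftrightarrow> (u, v) \<in> (parcs G)\<^sup>*"
    if "u \<in> pverts G" "v \<in> pverts G" for u v
    using that wellformed' by (blast intro: rtrancl_on_rtranclI rtrancl_consistent_rtrancl_on)
  ultimately show ?thesis
    by (auto simp: connected_def strongly_connected_def reachable_def)
qed

lemma fs_verts_with_value:
  assumes "bij_betw \<sigma> (pverts X) (pverts Y)" "p \<in> pverts X" "y \<in> pverts Y"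
  obtains \<tau> where "\<tau> \<in> fs_verts X Y" "\<tau> p = y"
proof -
  obtain q where q: "q \<in> pverts X" "\<sigma> q = y"
    using assms by (metis bij_betw_imp_surj_on imageE)
  have "bij_betw (\<sigma> \<circ> transpose p q) (pverts X) (pverts Y)"
    using assms q by (intro bij_betw_comp_transpose)
  then have "bij_betw (restrict (\<sigma> \<circ> transpose p q) (pverts X)) (pverts X) (pverts Y)"
    by (rule iffD1[OF bij_betw_cong, rotated]) simp
  then show ?thesis
    using that[of "restrict (\<sigma> \<circ> transpose p q) (pverts X)"] assms q by (auto simp: fs_verts_def)
qed

section \<open>Necessity: the invariant, and the resulting criterion\<close>

lemma pverts_lollipop [simp]: "pverts (lollipop m k) = {1..m + k}"
  by (simp add: lollipop_def ugraph_def)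

text \<open>Adjacent members of \<open>S\<close> lie on the same side of the cut, so exchanging them
  keeps the side of the first one. Otherwise the first member can only step along the path: to jump
  past \<open>m + 1\<close> it would need \<open>m + 1\<close> outsiders.\<close>

lemma fs_lollipop_invariant:
  assumes "pair_graph Y" "1 \<le> k" "card (pverts Y - S) = m"
    and sep: "parcs Y \<inter> A \<times> (S - A) = {}" and "A \<subseteq> S"
    and "(\<sigma>, \<tau>) \<in> parcs (fs_graph (lollipop m k) Y)"
    and inv: "\<exists>l \<in> {1..m + 1}. \<sigma> l \<in> A \<and> (\<forall>i \<in> {1..<l}. \<sigma> i \<notin> S)"
  shows "\<exists>l \<in> {1..m + 1}. \<tau> l \<in> A \<and> (\<forall>i \<in> {1..<l}. \<tau> i \<notin> S)"
proof -
  interpret Y: pair_graph Y by fact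
  have sym: "(y, x) \<in> parcs Y" if "(x, y) \<in> parcs Y" for x y
    using that Y.pair_sym_arcs by (auto simp: symmetric_def dest: symD)
  have arc: "(\<sigma>, \<tau>) \<in> swap_rel (parcs (lollipop m k)) (parcs Y)" "\<sigma> \<in> fs_verts (lollipop m k) Y"
    using assms(6) unfolding parcs_fs_graph[OF pair_graph_lollipop[OF \<open>1 \<le> k\<close>]] by auto
  obtain a b where ab: "a < b" "1 \<le> a" "b \<le> m + k" "b = Suc a \<or> m < a"
    "(\<sigma> a, \<sigma> b) \<in> parcs Y" and \<tau>: "\<tau> = \<sigma> \<circ> transpose a b"
  proof -
    obtain a b where *: "(a, b) \<in> parcs (lollipop m k)" "(\<sigma> a, \<sigma> b) \<in> parcs Y" "\<tau> = \<sigma> \<circ> transpose a b"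
      using arc(1) by (auto simp: swap_rel_def)
    have "a \<noteq> b"
      using *(1) \<open>1 \<le> k\<close> by (simp add: parcs_lollipop)
    then consider "a < b" | "b < a"
      by linarith
    then show ?thesis
    proof cases
      case 1
      with * that \<open>1 \<le> k\<close> show ?thesis
        by (auto simp: parcs_lollipop)
    next
      case 2
      with * sym that[of b a] \<open>1 \<le> k\<close> show ?thesis
        by (auto simp: parcs_lollipop transpose_commute)
    qed
  qed
  have \<tau>_eq: "\<tau> a = \<sigma> b" "\<tau> b = \<sigma> a" "\<And>c. c \<noteq> a \<Longrightarrow> c \<noteq> b \<Longrightarrow> \<tau> c = \<sigma> c"
    by (auto simp: \<tau> transpose_def)
  obtain l where l: "1 \<le> l" "l \<le> m + 1" "\<sigma> l \<in> A" "\<And>i. 1 \<le> i \<Longrightarrow> i < l \<Longrightarrow> \<sigma> i \<notin> S"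
    using inv by auto
  have \<sigma>: "bij_betw \<sigma> {1..m + k} (pverts Y)"
    using arc(2) by (simp add: fs_verts_def)
  have goal: ?thesis if "1 \<le> l'" "l' \<le> m + 1" "\<tau> l' \<in> A" "\<And>i. 1 \<le> i \<Longrightarrow> i < l' \<Longrightarrow> \<tau> i \<notin> S" for l'
    using that by auto
  \<comment> \<open>The cases place the first member's position \<open>l\<close> relative to the
    swapped positions \<open>a < b\<close>. The last one cannot occur: an edge skipping a position
    lies in the clique, whereas \<open>l \<le> m + 1\<close>.\<close>
  consider "l < a" | "l = a" "\<sigma> b \<in> S" | "l = a" "\<sigma> b \<notin> S" | "l = b" | "b < l" | "a < l" "l < b"
    by linarith
  then show ?thesis
  proof cases
    case 1
    then show ?thesis
      using l ab \<tau>_eq by (intro goal[of l]) auto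
  next
    case 2
    then have "\<sigma> b \<in> A"
      using sep ab(5) l(3) by auto
    then show ?thesis
      using 2 l ab \<tau>_eq by (intro goal[of l]) auto
  next
    case 3
    \<comment> \<open>Otherwise positions \<open>1\<close> to \<open>m\<close> and \<open>b\<close>
      would hold \<open>m + 1\<close> different people outside \<open>S\<close>.\<close>
    have "l \<noteq> m + 1"
    proof
      assume "l = m + 1"
      have "\<sigma> i \<in> pverts Y" if "i \<in> insert b {1..m}" for i
        using that ab \<sigma> 3 \<open>l = m + 1\<close> by (intro bij_betw_apply[OF \<sigma>]) auto
      then have "\<sigma> ` insert b {1..m} \<subseteq> pverts Y - S"
        using 3 l(4) \<open>l = m + 1\<close> by auto
      moreover have "inj_on \<sigma> (insert b {1..m})"
        by (rule inj_on_subset[OF bij_betw_imp_inj_on[OF \<sigma>]]) (use ab in auto)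
      moreover have "card (insert b {1..m}) = Suc m"
        using 3 ab(1) \<open>l = m + 1\<close> by auto
      ultimately show False
        using assms(3) card_inj_on_le[of \<sigma> "insert b {1..m}" "pverts Y - S"] Y.pair_finite_verts
        by simp
    qed
    then have "b = Suc l" "b \<le> m + 1"
      using 3 l(2) ab(4) by auto
    moreover have "\<tau> i \<notin> S" if "1 \<le> i" "i < b" for i
      using that l(4)[of i] \<tau>_eq 3 \<open>b = Suc l\<close> by (cases "i = a") auto
    ultimately show ?thesis
      using 3 l(3) \<tau>_eq by (intro goal[of b]) auto
  next
    case 4
    \<comment> \<open>As \<open>l \<le> m + 1\<close>, position \<open>a\<close> is on the path, so
      the first member moves one step towards its end.\<close>
    then have "b = Suc a"
      using ab l by auto
    then show ?thesis
      using 4 l ab \<tau>_eq by (intro goal[of a]) auto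
  next
    case 5
    have "\<tau> i \<notin> S" if "1 \<le> i" "i < l" for i
      using that l(4)[of i] l(4)[of a] l(4)[of b] ab(1,2) 5 \<tau>_eq by (cases "i = a \<or> i = b") auto
    then show ?thesis
      using 5 l ab \<tau>_eq by (intro goal[of l]) auto
  next
    case 6
    then show ?thesis
      using ab l by auto
  qed
qed

theorem connected_fs_lollipop_iff:
  assumes "pair_graph Y" "2 \<le> k" "card (pverts Y) = m + k"
  shows "Digraph_Component.connected (with_proj (fs_graph (lollipop m k) Y)) \<longleftrightarrow>
    (\<forall>S \<subseteq> pverts Y. card S = k \<longrightarrow> inseparable (parcs Y) S)"
proof -
  interpret Y: pair_graph Y by fact
  let ?X = "lollipop m k"
  have X: "pair_graph ?X"
    using \<open>2 \<le> k\<close> by (intro pair_graph_lollipop) simp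
  have "sym (parcs Y)"
    using Y.pair_sym_arcs by (simp add: symmetric_def)
  obtain \<sigma>0 where \<sigma>0: "bij_betw \<sigma>0 {1..m + k} (pverts Y)"
    using assms(3) Y.pair_finite_verts by (metis finite_atLeastAtMost card_atLeastAtMost
        diff_Suc_1 plus_1_eq_Suc finite_same_card_bij)
  have start: "\<exists>\<sigma> \<in> fs_verts ?X Y. \<sigma> 1 = y" if "y \<in> pverts Y" for y
    by (rule fs_verts_with_value[of \<sigma>0 ?X Y 1 y]) (use \<sigma>0 that \<open>2 \<le> k\<close> in auto)
  have conn: "Digraph_Component.connected (with_proj (fs_graph ?X Y)) \<longleftrightarrow>
      (\<forall>\<sigma> \<in> fs_verts ?X Y. \<forall>\<tau> \<in> fs_verts ?X Y. (\<sigma>, \<tau>) \<in> (parcs (fs_graph ?X Y))\<^sup>*)"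
  proof -
    have "pverts Y \<noteq> {}"
      using assms(2,3) by auto
    then have "fs_verts ?X Y \<noteq> {}"
      using start by blast
    then show ?thesis
      by (simp add: connected_pair_graph_iff[OF pair_graph_fs_graph[OF X assms(1)]])
        (simp add: fs_graph_def)
  qed
  show ?thesis
    unfolding conn
  proof (intro iffI ballI allI impI)
    fix S assume all: "\<forall>\<sigma> \<in> fs_verts ?X Y. \<forall>\<tau> \<in> fs_verts ?X Y. (\<sigma>, \<tau>) \<in> (parcs (fs_graph ?X Y))\<^sup>*"
      and S: "S \<subseteq> pverts Y" "card S = k"
    show "inseparable (parcs Y) S"
    proof (rule ccontr)
      assume "\<not> inseparable (parcs Y) S"
      then obtain A where A: "A \<noteq> {}" "A \<subset> S" "parcs Y \<inter> A \<times> (S - A) = {}"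
        by (auto simp: inseparable_def)
      then obtain a b where ab: "a \<in> A" "b \<in> S" "b \<notin> A"
        by blast
      \<comment> \<open>Both arrangements have a member of \<open>S\<close> at position
        \<open>1\<close>, so \<open>l = 1\<close> is forced: the invariant holds for
        \<open>\<sigma>\<close> and fails for \<open>\<tau>\<close>.\<close>
      obtain \<sigma> \<tau> where st: "\<sigma> \<in> fs_verts ?X Y" "\<sigma> 1 = a" "\<tau> \<in> fs_verts ?X Y" "\<tau> 1 = b"
        using start[of a] start[of b] ab A(2) S(1) by blast
      have C: "card (pverts Y - S) = m"
        using S assms(3) Y.pair_finite_verts by (simp add: card_Diff_subset finite_subset)
      have "(\<sigma>, \<tau>) \<in> (parcs (fs_graph ?X Y))\<^sup>*"
        using all st by blast
      then have "\<exists>l \<in> {1..m + 1}. \<tau> l \<in> A \<and> (\<forall>i \<in> {1..<l}. \<tau> i \<notin> S)"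
      proof induction
        case base
        then show ?case
          using ab st by (intro bexI[of _ 1]) auto
      next
        case (step \<rho> \<tau>)
        show ?case
          by (rule fs_lollipop_invariant[OF assms(1) _ C A(3) _ step.hyps(2) step.IH])
            (use A \<open>2 \<le> k\<close> in auto)
      qed
      then obtain l where "1 \<le> l" "\<tau> l \<in> A" "\<And>i. 1 \<le> i \<Longrightarrow> i < l \<Longrightarrow> \<tau> i \<notin> S"
        by auto
      then show False
        using ab st by (cases "l = 1") auto
    qed
  next
    fix \<sigma> \<tau>
    assume ins: "\<forall>S \<subseteq> pverts Y. card S = k \<longrightarrow> inseparable (parcs Y) S"
      and st: "\<sigma> \<in> fs_verts ?X Y" "\<tau> \<in> fs_verts ?X Y"
    have "(\<sigma>, \<tau>) \<in> (swap_rel (parcs ?X) (parcs Y))\<^sup>*"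
    proof (rule lollipop_tail_connected[of _ _ 1 m])
      show "\<sigma> i = \<tau> i" if "i \<notin> {1..m + k}" for i
        using st that by (auto simp: fs_verts_def extensional_def)
    qed (use \<open>sym (parcs Y)\<close> assms ins st in \<open>auto simp: fs_verts_def\<close>)
    then show "(\<sigma>, \<tau>) \<in> (parcs (fs_graph ?X Y))\<^sup>*"
      using swap_rel_rtrancl_imp_fs_graph X st by blast
  qed
qed

section \<open>Induced copies and separated five-element sets\<close>

text \<open>Replaces isomorphism records by a vertex map. Arcs are pairs, so the vertex map
  determines the arc map.\<close>

lemma has_induced_copy_iff:
  assumes "pair_graph Y" "pair_graph H"
  shows "has_induced_copy Y H \<longleftrightarrow>
    (\<exists>U g. U \<subseteq> pverts Y \<and> bij_betw g U (pverts H) \<and>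
      (\<forall>x \<in> U. \<forall>y \<in> U. (x, y) \<in> parcs Y \<longleftrightarrow> (g x, g y) \<in> parcs H))"
    (is "_ \<longleftrightarrow> ?R")
proof
  interpret Y: pair_graph Y by fact
  interpret H: pair_graph H by fact
  {
    assume "has_induced_copy Y H"
    then obtain K h where K: "induced_subgraph K (with_proj Y)"
      and h: "pre_digraph.digraph_isomorphism K h" "with_proj H = app_iso h K"
      by (auto simp: has_induced_copy_def digraph_iso_def)
    define g where "g = iso_verts h"
    have tail: "tail K = fst" "head K = snd" and V: "verts K \<subseteq> pverts Y"
      and arcs: "arcs K = {(x, y) \<in> parcs Y. x \<in> verts K \<and> y \<in> verts K}"
      using K by (auto simp: induced_subgraph_def subgraph_def compatible_def)
    have H: "pverts H = g ` verts K" "parcs H = iso_arcs h ` arcs K" "fst = iso_tail h" "snd = iso_head h"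
      using h(2) unfolding g_def by (metis with_proj_simps app_iso_simps)+
    have inj: "inj_on g (verts K)"
      and hom: "\<And>a. a \<in> arcs K \<Longrightarrow> iso_arcs h a = (g (fst a), g (snd a))"
      using h(1) by (simp_all add: pre_digraph.digraph_isomorphism_def g_def tail H(3,4)[symmetric] prod_eq_iff)
    have "(x, y) \<in> parcs Y \<longleftrightarrow> (g x, g y) \<in> parcs H" if xy: "x \<in> verts K" "y \<in> verts K" for x y
    proof
      assume "(x, y) \<in> parcs Y"
      with xy have "(x, y) \<in> arcs K"
        by (simp add: arcs)
      then show "(g x, g y) \<in> parcs H"
        using hom[of "(x, y)"] unfolding H(2) by (metis fst_conv image_eqI snd_conv)
    next
      assume "(g x, g y) \<in> parcs H"
      then obtain a where "a \<in> arcs K" "(g x, g y) = (g (fst a), g (snd a))"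
        using hom unfolding H(2) by auto
      then show "(x, y) \<in> parcs Y"
        using xy inj by (auto simp: arcs inj_on_eq_iff)
    qed
    then show ?R
      using V inj H(1) by (auto simp: bij_betw_def intro!: exI[of _ "verts K"] exI[of _ g])
  next
    assume ?R
    then obtain U g where U: "U \<subseteq> pverts Y" "bij_betw g U (pverts H)"
      and g: "\<And>x y. x \<in> U \<Longrightarrow> y \<in> U \<Longrightarrow> (x, y) \<in> parcs Y \<longleftrightarrow> (g x, g y) \<in> parcs H"
      by auto
    define K where "K = with_proj \<lparr>pverts = U, parcs = Restr (parcs Y) U\<rparr>"
    \<comment> \<open>Acting by \<open>g\<close> on both ends is the only arc map compatible with
      the projections as tail and head.\<close>
    define h where "h = \<lparr>iso_verts = g, iso_arcs = map_prod g g, iso_head = snd, iso_tail = fst\<rparr>"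
    have wf: "wf_digraph K"
      by unfold_locales (auto simp: K_def)
    then have "induced_subgraph K (with_proj Y)"
      using U Y.wf_digraph by (auto simp: induced_subgraph_def subgraph_def compatible_def K_def)
    moreover have "parcs H = map_prod g g ` (Restr (parcs Y) U)"
    proof (intro equalityI subsetI)
      fix e assume "e \<in> parcs H"
      moreover from this have "fst e \<in> g ` U" "snd e \<in> g ` U"
        using H.wellformed' U(2) by (auto simp: bij_betw_def)
      ultimately obtain x y where "x \<in> U" "y \<in> U" "e = (g x, g y)" "(x, y) \<in> parcs Y"
        using g by (metis imageE prod.collapse)
      then show "e \<in> map_prod g g ` (Restr (parcs Y) U)"
        by force
    qed (use g in auto)
    then have "with_proj H = app_iso h K"
      using U by (simp add: app_iso_def h_def K_def with_proj_def bij_betw_def)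
    moreover have "inj_on (map_prod g g) (Restr (parcs Y) U)"
      using map_prod_inj_on[of g U g U] U(2) by (auto simp: bij_betw_def elim: inj_on_subset)
    then have "pre_digraph.digraph_isomorphism K h"
      using wf bij_betw_imp_inj_on[OF U(2)] unfolding pre_digraph.digraph_isomorphism_def
      by (simp add: K_def h_def)
    ultimately show "has_induced_copy Y H"
      by (auto simp: has_induced_copy_def digraph_iso_def)
  }
qed

text \<open>The preimage of the \<open>Inl\<close> summand is a cut of the copy, proper because both
  graphs are nonempty.\<close>

lemma induced_disjoint_union_separable:
  assumes "pair_graph Y" "pair_graph G" "pair_graph H" "pverts G \<noteq> {}" "pverts H \<noteq> {}"
    and "has_induced_copy Y (disjoint_union G H)"
  obtains S where "S \<subseteq> pverts Y" "card S = card (pverts G) + card (pverts H)"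
    "\<not> inseparable (parcs Y) S"
proof -
  obtain U g where U: "U \<subseteq> pverts Y" and g: "bij_betw g U (pverts G <+> pverts H)"
    and hom: "\<And>x y. x \<in> U \<Longrightarrow> y \<in> U \<Longrightarrow> (x, y) \<in> parcs Y \<longleftrightarrow> (g x, g y) \<in> parcs (disjoint_union G H)"
    using assms(6) has_induced_copy_iff[OF assms(1) pair_graph_disjoint_union[OF assms(2,3)]]
    by (auto simp: disjoint_union_def)
  define A where "A = {x \<in> U. g x \<in> range Inl}"
  have "card U = card (pverts G) + card (pverts H)"
    using bij_betw_same_card[OF g] assms(2,3)
    by (simp add: card_Plus pair_graph_def pair_digraph_def pair_fin_digraph.pair_finite_verts)
  moreover have "parcs Y \<inter> A \<times> (U - A) = {}"
    using hom by (auto simp: A_def disjoint_union_def)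
  moreover obtain u v where "u \<in> pverts G" "v \<in> pverts H"
    using assms(4,5) by blast
  then obtain x y where "x \<in> U" "y \<in> U" "g x = Inl u" "g y = Inr v"
    using g by (metis InlI InrI bij_betw_imp_surj_on imageE)
  then have "x \<in> A" "y \<in> U - A" "A \<subseteq> U"
    by (auto simp: A_def)
  then have "A \<noteq> {}" "A \<subset> U"
    by auto
  ultimately show ?thesis
    using that U by (auto simp: inseparable_def)
qed

lemma small_graphs:
  "pverts (complete_graph m) = {1..m}" "pverts (path_graph m) = {1..m}"
  "parcs (complete_graph 3) = {(1, 2), (2, 1), (1, 3), (3, 1), (2, 3), (3, 2)}"
  "parcs (path_graph 3) = {(1, 2), (2, 1), (2, 3), (3, 2)}"
  "parcs (path_graph 2) = {(1, 2), (2, 1)}"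
  by (auto simp: complete_graph_def path_graph_def ugraph_def)

text \<open>Neighbours stay on their own side. Hence the pair is an edge and the triple has no
  isolated vertex, which leaves a path or a triangle.\<close>

lemma separated_triple_pair_induced_copy:
  assumes "pair_graph Y" "A \<subseteq> pverts Y" "B \<subseteq> pverts Y" "A \<inter> B = {}" "card A = 3" "card B = 2"
    and sep: "parcs Y \<inter> A \<times> B = {}"
    and nbr: "\<And>v. v \<in> A \<union> B \<Longrightarrow> \<exists>u \<in> A \<union> B. (v, u) \<in> parcs Y"
  shows "has_induced_copy Y (disjoint_union (complete_graph 3) (path_graph 2)) \<or>
    has_induced_copy Y (disjoint_union (path_graph 3) (path_graph 2))"
proof -
  interpret Y: pair_graph Y by fact
  have sym: "(v, u) \<in> parcs Y" if "(u, v) \<in> parcs Y" for u v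
    using that Y.pair_sym_arcs by (auto simp: symmetric_def dest: symD)
  have irr: "(u, u) \<notin> parcs Y" for u
    using Y.pair_no_loops[of "(u, u)"] by auto
  have no: "(u, v) \<notin> parcs Y" "(v, u) \<notin> parcs Y" if "u \<in> A" "v \<in> B" for u v
    using that sep sym[of v u] by auto
  have A: "\<exists>u \<in> A. (v, u) \<in> parcs Y" if "v \<in> A" for v
    using nbr[of v] that no by auto
  have B: "\<exists>u \<in> B. (v, u) \<in> parcs Y" if "v \<in> B" for v
    using nbr[of v] that no by auto
  obtain p q where B_eq: "B = {p, q}" "p \<noteq> q"
    using \<open>card B = 2\<close> by (auto simp: card_2_iff)
  have pq: "(p, q) \<in> parcs Y"
    using B[of p] B_eq irr by auto
  obtain x y z where A_eq: "A = {x, y, z}" "x \<noteq> y" "y \<noteq> z" "x \<noteq> z"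
    and xyz: "(x, y) \<in> parcs Y" "(y, z) \<in> parcs Y"
  proof -
    obtain a b c where abc: "A = {a, b, c}" "a \<noteq> b" "b \<noteq> c" "a \<noteq> c"
      using \<open>card A = 3\<close> by (auto simp: card_3_iff)
    have "\<exists>u\<in>{a, b, c}. (a, u) \<in> parcs Y" "\<exists>u\<in>{a, b, c}. (b, u) \<in> parcs Y"
      "\<exists>u\<in>{a, b, c}. (c, u) \<in> parcs Y"
      using A abc by auto
    then have "(a, b) \<in> parcs Y \<or> (a, c) \<in> parcs Y" "(b, a) \<in> parcs Y \<or> (b, c) \<in> parcs Y"
      "(c, a) \<in> parcs Y \<or> (c, b) \<in> parcs Y"
      using irr by auto
    \<comment> \<open>The cases say which vertex, \<open>b\<close>, \<open>a\<close> or
      \<open>c\<close>, is the middle of a path through the triple; it becomes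
      \<open>y\<close>.\<close>
    then consider "(a, b) \<in> parcs Y" "(b, c) \<in> parcs Y" | "(b, a) \<in> parcs Y" "(a, c) \<in> parcs Y"
      | "(a, c) \<in> parcs Y" "(c, b) \<in> parcs Y"
      using sym by metis
    then show ?thesis
    proof cases
      case 1
      with abc that[of a b c] show ?thesis by blast
    next
      case 2
      with abc that[of b a c] show ?thesis by blast
    next
      case 3
      with abc that[of a c b] show ?thesis by blast
    qed
  qed
  \<comment> \<open>Sending the middle vertex \<open>y\<close> to \<open>2\<close> serves both
    targets, which differ only in the edge between \<open>1\<close> and \<open>3\<close>.\<close>
  define g :: "'a \<Rightarrow> nat + nat" where
    "g v = (if v = x then Inl 1 else if v = y then Inl 2 else if v = z then Inl 3
      else if v = p then Inr 1 else Inr 2)" for v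
  have ne: "x \<noteq> p" "x \<noteq> q" "y \<noteq> p" "y \<noteq> q" "z \<noteq> p" "z \<noteq> q"
    using \<open>A \<inter> B = {}\<close> A_eq B_eq by auto
  have g: "g x = Inl 1" "g y = Inl 2" "g z = Inl 3" "g p = Inr 1" "g q = Inr 2"
    using A_eq B_eq ne by (auto simp: g_def)
  have yx: "(y, x) \<in> parcs Y" "(z, y) \<in> parcs Y" "(q, p) \<in> parcs Y"
    using xyz pq by (simp_all add: sym)
  have "{1..3} = {1, 2, 3 :: nat}" "{1..2} = {1, 2 :: nat}"
    by auto
  then have bij: "bij_betw g (A \<union> B) ({1..3} <+> {1..2})"
    using A_eq B_eq ne by (auto simp: bij_betw_def inj_on_def g Plus_def)
  have copy: "has_induced_copy Y (disjoint_union G (path_graph 2))"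
    if "pair_graph G" "pverts G = {1..3}"
      "\<forall>u \<in> A \<union> B. \<forall>v \<in> A \<union> B. (u, v) \<in> parcs Y \<longleftrightarrow>
        (g u, g v) \<in> parcs (disjoint_union G (path_graph 2))" for G
  proof -
    have "bij_betw g (A \<union> B) (pverts (disjoint_union G (path_graph 2)))"
      using bij by (simp add: disjoint_union_def that(2) small_graphs)
    then show ?thesis
      unfolding has_induced_copy_iff[OF assms(1) pair_graph_disjoint_union[OF that(1) pair_graph_path_graph]]
      using assms(2,3) that(3) by (intro exI[of _ "A \<union> B"] exI[of _ g]) simp
  qed
  show ?thesis
  proof (cases "(x, z) \<in> parcs Y")
    case True
    then have "(z, x) \<in> parcs Y"
      by (rule sym)
    with True have "\<forall>u \<in> A \<union> B. \<forall>v \<in> A \<union> B. (u, v) \<in> parcs Y \<longleftrightarrow>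
        (g u, g v) \<in> parcs (disjoint_union (complete_graph 3) (path_graph 2))"
      using xyz pq yx no[unfolded A_eq(1) B_eq(1)] irr by (simp add: A_eq(1) B_eq(1) g disjoint_union_def small_graphs)
    then show ?thesis
      by (intro disjI1 copy pair_graph_complete_graph small_graphs)
  next
    case False
    then have "(z, x) \<notin> parcs Y"
      using sym[of z x] by blast
    with False have "\<forall>u \<in> A \<union> B. \<forall>v \<in> A \<union> B. (u, v) \<in> parcs Y \<longleftrightarrow>
        (g u, g v) \<in> parcs (disjoint_union (path_graph 3) (path_graph 2))"
      using xyz pq yx no[unfolded A_eq(1) B_eq(1)] irr by (simp add: A_eq(1) B_eq(1) g disjoint_union_def small_graphs)
    then show ?thesis
      by (intro disjI2 copy pair_graph_path_graph small_graphs)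
  qed
qed

section \<open>Minimum degree and the case of five vertices\<close>

text \<open>Without a neighbour in \<open>S\<close>, the degree of \<open>v\<close> would be at most
  the number of vertices outside \<open>S\<close>, which is below the minimum degree.\<close>

lemma min_degree_neighbour:
  assumes "pair_graph Y" "v \<in> pverts Y" "S \<subseteq> pverts Y" "card (pverts Y) < min_degree Y + card S"
  obtains u where "u \<in> S" "(v, u) \<in> parcs Y"
proof (rule ccontr)
  interpret Y: pair_graph Y by fact
  assume "\<not> thesis"
  then have none: "\<And>u. u \<in> S \<Longrightarrow> (v, u) \<notin> parcs Y"
    using that by blast
  have "min_degree Y \<le> out_degree (with_proj Y) v"
    unfolding min_degree_def using assms(2) Y.pair_finite_verts by simp
  also have "\<dots> = card (snd ` out_arcs (with_proj Y) v)"
    unfolding out_degree_def by (intro card_image[symmetric]) (auto simp: inj_on_def)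
  also have "\<dots> \<le> card (pverts Y - S)"
    using none Y.wellformed' Y.pair_finite_verts by (intro card_mono) auto
  also have "\<dots> = card (pverts Y) - card S"
    using assms(3) Y.pair_finite_verts by (simp add: card_Diff_subset finite_subset)
  finally show False
    using assms(4) card_mono[OF Y.pair_finite_verts assms(3)] by linarith
qed

theorem corollary1p7:
  fixes n :: nat and Y :: "'a pair_pre_digraph"
  assumes "n \<ge> 5"
    and "pair_graph Y"
    and "card (pverts Y) = n"
    and "min_degree Y = n - 4"
  shows "Digraph_Component.connected (with_proj (fs_graph (lollipop (n - 5) 5) Y)) \<longleftrightarrow>
    \<not> has_induced_copy Y (disjoint_union (complete_graph 3) (path_graph 2)) \<and>
    \<not> has_induced_copy Y (disjoint_union (path_graph 3) (path_graph 2))"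
proof -
  interpret Y: pair_graph Y by fact
  have "Digraph_Component.connected (with_proj (fs_graph (lollipop (n - 5) 5) Y)) \<longleftrightarrow>
      (\<forall>S \<subseteq> pverts Y. card S = 5 \<longrightarrow> inseparable (parcs Y) S)"
    using assms by (intro connected_fs_lollipop_iff) auto
  also have "\<dots> \<longleftrightarrow> \<not> has_induced_copy Y (disjoint_union (complete_graph 3) (path_graph 2)) \<and>
      \<not> has_induced_copy Y (disjoint_union (path_graph 3) (path_graph 2))"
  proof (intro iffI conjI notI allI impI)
    assume ins: "\<forall>S \<subseteq> pverts Y. card S = 5 \<longrightarrow> inseparable (parcs Y) S"
    {
      assume "has_induced_copy Y (disjoint_union (complete_graph 3) (path_graph 2))"
      then show False
        by (rule induced_disjoint_union_separable[rotated 5])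
          (use ins assms(2) in \<open>auto simp: small_graphs pair_graph_complete_graph pair_graph_path_graph\<close>)
    next
      assume "has_induced_copy Y (disjoint_union (path_graph 3) (path_graph 2))"
      then show False
        by (rule induced_disjoint_union_separable[rotated 5])
          (use ins assms(2) in \<open>auto simp: small_graphs pair_graph_path_graph\<close>)
    }
  next
    fix S
    assume no: "\<not> has_induced_copy Y (disjoint_union (complete_graph 3) (path_graph 2)) \<and>
      \<not> has_induced_copy Y (disjoint_union (path_graph 3) (path_graph 2))"
      and S: "S \<subseteq> pverts Y" "card S = 5"
    \<comment> \<open>The degree bound is just met: \<open>n < (n - 4) + 5\<close>.\<close>
    have nbr: "\<exists>u \<in> S. (v, u) \<in> parcs Y" if "v \<in> S" for v
      by (rule min_degree_neighbour[OF assms(2) _ S(1)]) (use that S assms in auto)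
    have fin: "finite S"
      using S by (simp add: card_ge_0_finite)
    show "inseparable (parcs Y) S"
    proof (rule ccontr)
      assume "\<not> inseparable (parcs Y) S"
      then obtain A where A: "A \<noteq> {}" "A \<subset> S" "parcs Y \<inter> A \<times> (S - A) = {}"
        by (auto simp: inseparable_def)
      define B where "B = S - A"
      have AB: "S = A \<union> B" "A \<inter> B = {}" "A \<noteq> {}" "B \<noteq> {}" "finite A" "finite B"
        using A(1,2) fin by (auto simp: B_def finite_subset)
      have sep: "parcs Y \<inter> A \<times> B = {}" "parcs Y \<inter> B \<times> A = {}"
        using A(3) Y.pair_sym_arcs by (auto simp: B_def symmetric_def dest: symD)
      \<comment> \<open>A one-element side of a cut would be a vertex with no neighbour in
        \<open>S\<close>.\<close>
      have card_ne_1: "card C \<noteq> 1" if C: "C \<subseteq> S" "parcs Y \<inter> C \<times> (S - C) = {}" for C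
      proof
        assume "card C = 1"
        then obtain c where "C = {c}"
          by (auto simp: card_1_singleton_iff)
        then show False
          using nbr[of c] C Y.pair_no_loops[of "(c, c)"] by auto
      qed
      have "card A + card B = 5"
        using S(2) AB by (simp add: card_Un_disjoint)
      moreover have "card A > 0" "card B > 0"
        using AB by (simp_all add: card_gt_0_iff)
      moreover have "card A \<noteq> 1" "card B \<noteq> 1"
        using card_ne_1[of A] card_ne_1[of B] A(2,3) sep(2) by (auto simp: B_def double_diff)
      \<comment> \<open>Two sides of size at least two with sum five; the cut does not tell which is
        the larger.\<close>
      ultimately consider "card A = 3" "card B = 2" | "card A = 2" "card B = 3"
        by linarith
      then show False
      proof cases
        case 1
        show ?thesis
          using separated_triple_pair_induced_copy[OF assms(2) _ _ AB(2) 1 sep(1)] nbr S(1) no AB(1)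
          by blast
      next
        case 2
        show ?thesis
          using separated_triple_pair_induced_copy[OF assms(2) _ _ _ 2(2,1) sep(2)] nbr S(1) no AB(1,2)
          by blast
      qed
    qed
  qed
  finally show ?thesis .
qed

end
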